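(* Let $(\Omega,\mathcal F,P)$ be a probability space, let $X$ be a binary random variable (treatment) with values in $\{0,1\}$, and let $Z_1,\dots,Z_K$ be finite discrete random variables (matching covariates) on it. For $1\le k\le K$ let $\Omega^M_{1:k}\subseteq\Omega$ be the subset on which matched pairs are found with positive probability when $\boldsymbol Z_{1:k}=(Z_1,\dots,Z_k)$ are used as matching variables in exact paired matching. Then for every $1\le k<K$, $$\Omega^M_{1:k}\supseteq\Omega^M_{1:(k+1)}.$$
   Context: Let $Z_j(\Omega)$ denote the (finite) image of $Z_j$ and $\boldsymbol Z_{1:k}(\Omega)=Z_1(\Omega)\times\cdots\times Z_k(\Omega)$. Let $\mathcal Z_{1:k}$ be the set of covariate values for which both treatment and non-treatment occur with positive probability: $$\mathcal Z_{1:k}=\left\{\boldsymbol z_{1:k}\in\boldsymbol Z_{1:k}(\Omega):\ P\left(X^{-1}(1)\cap\boldsymbol Z_{1:k}^{-1}(\boldsymbol z_{1:k})\right)>0\ \text{ and }\ P\left(X^{-1}(0)\cap\boldsymbol Z_{1:k}^{-1}(\boldsymbol z_{1:k})\right)>0\right\}.$$ Then $$\Omega^M_{1:k}=\bigcup_{\boldsymbol z_{1:k}\in\mathcal Z_{1:k}}\boldsymbol Z_{1:k}^{-1}(\boldsymbol z_{1:k}).$$ *)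

theory Defs
  imports "HOL-Probability.Probability"
begin

text \<open>
  The covariates \<open>Z 1, Z 2, \<dots>\<close> share one value type \<open>'c\<close>, which may be any type; each has its
  own image \<open>Z j ` space M\<close>. Tuples indexed by \<open>{1..k}\<close> are extensional functions on
  \<open>{1..k}\<close>, so that equality of tuples is equality of their components.
\<close>

definition covariate_tuple :: "(nat \<Rightarrow> 'w \<Rightarrow> 'c) \<Rightarrow> nat \<Rightarrow> 'w \<Rightarrow> (nat \<Rightarrow> 'c)" where
  "covariate_tuple Z k \<omega> = (\<lambda>j\<in>{1..k}. Z j \<omega>)"

definition covariate_values :: "'w measure \<Rightarrow> (nat \<Rightarrow> 'w \<Rightarrow> 'c) \<Rightarrow> nat \<Rightarrow> (nat \<Rightarrow> 'c) set" where
  "covariate_values M Z k = (\<Pi>\<^sub>E j\<in>{1..k}. Z j ` space M)"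

definition matchable_values ::
    "'w measure \<Rightarrow> ('w \<Rightarrow> nat) \<Rightarrow> (nat \<Rightarrow> 'w \<Rightarrow> 'c) \<Rightarrow> nat \<Rightarrow> (nat \<Rightarrow> 'c) set" where
  "matchable_values M X Z k =
     {z \<in> covariate_values M Z k.
        measure M (X -` {1} \<inter> covariate_tuple Z k -` {z} \<inter> space M) > 0 \<and>
        measure M (X -` {0} \<inter> covariate_tuple Z k -` {z} \<inter> space M) > 0}"

definition matched_subset ::
    "'w measure \<Rightarrow> ('w \<Rightarrow> nat) \<Rightarrow> (nat \<Rightarrow> 'w \<Rightarrow> 'c) \<Rightarrow> nat \<Rightarrow> 'w set" where
  "matched_subset M X Z k =
     (\<Union>z\<in>matchable_values M X Z k. covariate_tuple Z k -` {z} \<inter> space M)"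

end

theory Submission
  imports Defs
begin

text \<open>A point lies in the matched subset exactly when its own covariate cell (the points
  sharing its tuple) meets both treatment levels in positive measure; this is
  \<open>mem_matched_subset_iff\<close>. Adding a covariate refines the partition into cells, so the
  cell of \<open>w\<close> for \<open>k + 1\<close> covariates sits inside its cell for
  \<open>k\<close>. Positivity passes to the larger cell by monotonicity of the measure, with
  measurability of that cell supplied by \<open>sets_covariate_tuple_fibre\<close>.\<close>

lemma covariate_tuple_eq_iff:
  "covariate_tuple Z k v = covariate_tuple Z k w \<longleftrightarrow> (\<forall>j\<in>{1..k}. Z j v = Z j w)"
  by (auto simp: covariate_tuple_def fun_eq_iff restrict_def)

text \<open>The fibres over distinct tuples are disjoint, so the only tuple in the union that can
  witness \<open>w\<close> is that of \<open>w\<close> itself, and for \<open>w\<close> in the space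
  this tuple is automatically in \<open>covariate_values\<close>. This removes the union and lets
  the main proof fix one point.\<close>

lemma mem_matched_subset_iff:
  "w \<in> matched_subset M X Z k \<longleftrightarrow>
     w \<in> space M \<and> (\<forall>x\<in>{0, 1}. measure M (X -` {x} \<inter>
        covariate_tuple Z k -` {covariate_tuple Z k w} \<inter> space M) > 0)"
  unfolding matched_subset_def matchable_values_def covariate_values_def
  by (auto simp: covariate_tuple_def)

text \<open>The fibre is a finite intersection, over \<open>j\<close>, of level sets of the simple
  functions \<open>Z j\<close>.\<close>

lemma sets_covariate_tuple_fibre:
  assumes "\<And>j. j \<in> {1..k} \<Longrightarrow> simple_function M (Z j)"
  shows "covariate_tuple Z k -` {covariate_tuple Z k w} \<inter> space M \<in> sets M"
proof -
  have "covariate_tuple Z k -` {covariate_tuple Z k w} \<inter> space M =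
      {v \<in> space M. \<forall>j\<in>{1..k}. v \<in> Z j -` {Z j w} \<inter> space M}"
    using covariate_tuple_eq_iff[of Z k _ w] by auto
  also have "\<dots> \<in> sets M"
  proof (rule sets.sets_Collect_finite_All)
    fix j assume "j \<in> {1..k}"
    then have "Z j -` {Z j w} \<inter> space M \<in> sets M"
      by (intro simple_functionD(2) assms)
    moreover have "{v \<in> space M. v \<in> Z j -` {Z j w} \<inter> space M} = Z j -` {Z j w} \<inter> space M"
      by auto
    ultimately show "{v \<in> space M. v \<in> Z j -` {Z j w} \<inter> space M} \<in> sets M"
      by simp
  qed simp
  finally show ?thesis .
qed

theorem theorem3:
  fixes M :: "'w measure" and X :: "'w \<Rightarrow> nat" and Z :: "nat \<Rightarrow> 'w \<Rightarrow> 'c" and K k :: nat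
  assumes "prob_space M"
    and "X \<in> measurable M (count_space {0, 1})"
    and "\<And>j. j \<in> {1..K} \<Longrightarrow> simple_function M (Z j)"
    and "1 \<le> k" and "k < K"
  shows "matched_subset M X Z (k + 1) \<subseteq> matched_subset M X Z k"
proof
  interpret prob_space M by fact
  fix w assume w: "w \<in> matched_subset M X Z (k + 1)"
  let ?A = "\<lambda>x l. X -` {x} \<inter> covariate_tuple Z l -` {covariate_tuple Z l w} \<inter> space M"
  have "measure M (?A x k) > 0" if x: "x \<in> {0, 1}" for x
  proof -
    \<comment> \<open>Monotonicity needs the larger set \<open>?A x k\<close> to be measurable,
      since \<open>measure\<close> is 0 by default outside \<open>sets M\<close>.\<close>
    have "X -` {x} \<inter> space M \<in> sets M"
      using assms(2) x by (intro measurable_sets[where A = "count_space {0, 1}"]) auto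
    moreover have "covariate_tuple Z k -` {covariate_tuple Z k w} \<inter> space M \<in> sets M"
      using assms(3,5) by (intro sets_covariate_tuple_fibre) auto
    moreover have "?A x k = (X -` {x} \<inter> space M) \<inter>
        (covariate_tuple Z k -` {covariate_tuple Z k w} \<inter> space M)"
      by auto
    ultimately have "?A x k \<in> sets M"
      by simp
    \<comment> \<open>Agreement with \<open>w\<close> on \<open>{1..k + 1}\<close> implies agreement
      on \<open>{1..k}\<close>.\<close>
    moreover have "?A x (k + 1) \<subseteq> ?A x k"
      using covariate_tuple_eq_iff[of Z k _ w] covariate_tuple_eq_iff[of Z "k + 1" _ w] by auto
    ultimately have "measure M (?A x (k + 1)) \<le> measure M (?A x k)"
      by (intro finite_measure_mono)
    moreover have "measure M (?A x (k + 1)) > 0"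
      using w x unfolding mem_matched_subset_iff by blast
    ultimately show ?thesis
      by linarith
  qed
  with w show "w \<in> matched_subset M X Z k"
    unfolding mem_matched_subset_iff by blast
qed

end
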